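(* Let $n$ be a positive integer. If $S$ is an $n$-admissible lucky set, then the sets $S$ and $S\cup\{2n+1\}$ are both $(n+1)$-admissible lucky sets.
   Context: A Stirling permutation of order $n$ is a permutation $w = w(1)w(2)\cdots w(2n)$ of the multiset $\{1,1,2,2,\ldots,n,n\}$ such that any value $j$ appearing between the two instances of $i$ satisfies $j>i$. $Q_n$ denotes the set of Stirling permutations of order $n$. Parking interpretation: there is a one-way street with spots $1,\ldots,2n$ (in this order), and cars $1,2,\ldots,2n$ arrive in order, car $i$ having preferred spot $w(i)$. Car $i$ parks in spot $w(i)$ if it is available; otherwise it continues down the street and parks in the first available spot after $w(i)$. For every $w\in Q_n$ all cars park. Car $i$ is lucky if it parks in its preferred spot $w(i)$, and unlucky otherwise. $\mathrm{Lucky}(w)\subseteq\{1,\ldots,2n\}$ denotes the set of lucky cars (car indices) of $w$. A subset $S\subseteq\{1,\ldots,2n\}$ is an $n$-admissible lucky set if there exists $w\in Q_n$ such that $\mathrm{Lucky}(w)=S$. *)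

theory Defs
  imports "HOL-Library.Multiset"
begin

text \<open>
  A word \<open>w(1) w(2) \<dots>\<close> is a list, so \<open>w(i)\<close> is \<open>w ! (i - 1)\<close>.  Spots, cars and values are
  numbered from 1.
\<close>

definition stirling_permutations :: "nat \<Rightarrow> nat list set" where
  "stirling_permutations n =
     {w. mset w = mset_set {1..n} + mset_set {1..n} \<and>
         (\<forall>a b c. a < b \<and> b < c \<and> c < length w \<and> w ! a = w ! c \<longrightarrow> w ! a < w ! b)}"

text \<open>
  The spot taken on a street with spots \<open>1, \<dots>, m\<close> by a car with preferred spot \<open>p\<close>, when the
  spots in \<open>occ\<close> are already taken; \<open>None\<close> if the car leaves the street without parking.
\<close>

definition park_spot :: "nat \<Rightarrow> nat set \<Rightarrow> nat \<Rightarrow> nat option" where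
  "park_spot m occ p =
     (if p \<in> {1..m} \<and> p \<notin> occ then Some p
      else find (\<lambda>s. s \<notin> occ) [p + 1..<m + 1])"

text \<open>The spots taken after cars \<open>1, \<dots>, k\<close> have arrived.\<close>

primrec occupied :: "nat \<Rightarrow> nat list \<Rightarrow> nat \<Rightarrow> nat set" where
  "occupied m w 0 = {}"
| "occupied m w (Suc k) =
     occupied m w k \<union> set_option (park_spot m (occupied m w k) (w ! k))"

definition car_spot :: "nat list \<Rightarrow> nat \<Rightarrow> nat option" where
  "car_spot w i = park_spot (length w) (occupied (length w) w (i - 1)) (w ! (i - 1))"

definition lucky :: "nat list \<Rightarrow> nat set" where
  "lucky w = {i \<in> {1..length w}. car_spot w i = Some (w ! (i - 1))}"

definition admissible_lucky_set :: "nat \<Rightarrow> nat set \<Rightarrow> bool" where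
  "admissible_lucky_set n S \<longleftrightarrow>
     S \<subseteq> {1..2 * n} \<and> (\<exists>w \<in> stirling_permutations n. lucky w = S)"

end

theory Submission
  imports Defs
begin

text \<open>
  Let \<open>w\<close> be a Stirling permutation of order \<open>n\<close> with lucky set \<open>S\<close>. Its \<open>2n\<close> cars fill the spots
  \<open>1, \<dots>, 2n\<close>, so in \<open>w (n+1) (n+1)\<close> the first \<open>2n\<close> cars park as before and the two new cars are
  unlucky, as \<open>n + 1 \<le> 2n\<close>. In \<open>(w+1) 1 1\<close>, where every value of \<open>w\<close> is raised by one, the first
  \<open>2n\<close> cars park one spot further than before; spot \<open>1\<close> is then free, so car \<open>2n+1\<close> is lucky and
  car \<open>2n+2\<close> is not.
\<close>

section \<open>Parking\<close>

text \<open>Testing the preferred spot is just the first step of the search. For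
  \<open>p = 0\<close> the search would start at spot 0, which is not on the street.\<close>

lemma park_spot_eq_find:
  assumes "p \<ge> 1"
  shows "park_spot m occ p = find (\<lambda>s. s \<notin> occ) [p..<m + 1]"
proof (cases "p \<le> m")
  case True
  then have "[p..<m + 1] = p # [p + 1..<m + 1]"
    by (simp add: upt_conv_Cons del: upt_Suc)
  with True assms show ?thesis
    by (simp add: park_spot_def del: upt_Suc)
qed (simp add: park_spot_def)

lemma park_spot_eq_Some_iff:
  assumes "p \<ge> 1"
  shows "park_spot m occ p = Some s \<longleftrightarrow> p \<le> s \<and> s \<le> m \<and> s \<notin> occ \<and> {p..<s} \<subseteq> occ"
proof
  assume "park_spot m occ p = Some s"
  then obtain i where i: "i < m + 1 - p" "s = p + i" "s \<notin> occ" "\<And>j. j < i \<Longrightarrow> p + j \<in> occ"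
    by (auto simp: park_spot_eq_find[OF assms] find_Some_iff simp del: upt_Suc)
  have "x \<in> occ" if "p \<le> x" "x < s" for x
    using i(4)[of "x - p"] i(2) that by auto
  with i show "p \<le> s \<and> s \<le> m \<and> s \<notin> occ \<and> {p..<s} \<subseteq> occ"
    by auto
next
  assume "p \<le> s \<and> s \<le> m \<and> s \<notin> occ \<and> {p..<s} \<subseteq> occ"
  then show "park_spot m occ p = Some s"
    by (auto simp: park_spot_eq_find[OF assms] find_Some_iff subset_iff
        simp del: upt_Suc intro!: exI[of _ "s - p"])
qed

lemma park_spot_eq_None_iff:
  assumes "p \<ge> 1"
  shows "park_spot m occ p = None \<longleftrightarrow> {p..m} \<subseteq> occ"
  by (auto simp: park_spot_eq_find[OF assms] find_None_iff subset_iff simp del: upt_Suc)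

text \<open>Searched and occupied spots move together. The longer street is harmless because the
  search already ends at \<open>s\<close>; a car that fails to park might succeed there.\<close>

lemma park_spot_shift:
  assumes "p \<ge> 1" "park_spot m occ p = Some s" "d + m \<le> m'"
  shows "park_spot m' ((+) d ` occ) (d + p) = Some (d + s)"
proof -
  have s: "p \<le> s" "s \<le> m" "s \<notin> occ" "{p..<s} \<subseteq> occ"
    using assms by (auto simp: park_spot_eq_Some_iff)
  then have "(+) d ` {p..<s} \<subseteq> (+) d ` occ"
    by blast
  with s show ?thesis
    using assms by (auto simp: park_spot_eq_Some_iff)
qed

lemma one_le_nth:
  assumes "(0::nat) \<notin> set w" "k < length w"
  shows "1 \<le> w ! k"
  using assms nth_mem[of k w] by (metis less_one not_le)

text \<open>Makes 0 a fictitious spot that is always free, so that a last free spot before a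
  preference always exists.\<close>

lemma zero_notin_occupied:
  assumes "0 \<notin> set w" "k \<le> length w"
  shows "0 \<notin> occupied m w k"
  using assms(2)
proof (induction k)
  case (Suc k)
  then have "w ! k \<ge> 1"
    using one_le_nth[OF assms(1)] by simp
  with Suc show ?case
    by (auto simp: park_spot_eq_Some_iff)
qed simp

text \<open>A car that parks beyond a spot that is free at the end never passed it.\<close>

lemma card_occupied_beyond_free_spot:
  assumes "0 \<notin> set w" "k \<le> length w" "j \<notin> occupied m w k"
  shows "finite (occupied m w k) \<and>
    card (occupied m w k \<inter> {j<..}) \<le> length (filter (\<lambda>x. j < x) (take k w))"
  using assms(2,3)
proof (induction k)
  case (Suc k)
  define occ where "occ = occupied m w k"
  have p: "w ! k \<ge> 1"
    using one_le_nth[OF assms(1)] Suc.prems(1) by simp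
  have IH: "finite occ" "card (occ \<inter> {j<..}) \<le> length (filter (\<lambda>x. j < x) (take k w))"
    using Suc by (auto simp: occ_def)
  have t: "take (Suc k) w = take k w @ [w ! k]"
    using Suc.prems(1) by (simp add: take_Suc_conv_app_nth)
  show ?case
  proof (cases "park_spot m occ (w ! k)")
    case None
    with IH show ?thesis
      by (simp add: t flip: occ_def)
  next
    case (Some s)
    then have s: "w ! k \<le> s" "{w ! k..<s} \<subseteq> occ"
      using p by (auto simp: park_spot_eq_Some_iff)
    have j: "j \<notin> occ" "j \<noteq> s"
      using Suc.prems(2) Some by (auto simp flip: occ_def)
    have "j < w ! k" if "j < s"
    proof (rule ccontr)
      assume "\<not> j < w ! k"
      with that have "j \<in> {w ! k..<s}"
        by simp
      with s(2) j(1) show False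
        by blast
    qed
    with IH show ?thesis
      using j Some by (auto simp: t card_insert_if Int_insert_left simp flip: occ_def)
  qed
qed simp

text \<open>Pigeonhole: if a car finds no spot, let \<open>j\<close> be the last free spot before
  its preference. All spots beyond \<open>j\<close> are taken, and by cars preferring spots beyond
  \<open>j\<close>. With the failing car these are more than \<open>length w - j\<close>, against
  \<open>few\<close>.\<close>

lemma park_spot_ne_None:
  assumes "0 \<notin> set w"
    and few: "\<And>j. j \<le> length w \<Longrightarrow> length (filter (\<lambda>x. j < x) w) \<le> length w - j"
    and k: "k < length w"
  shows "park_spot (length w) (occupied (length w) w k) (w ! k) \<noteq> None"
proof
  define m where "m = length w"
  define occ where "occ = occupied m w k"
  assume "park_spot (length w) (occupied (length w) w k) (w ! k) = None"
  moreover have p: "w ! k \<ge> 1"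
    using assms(1) k by (rule one_le_nth)
  ultimately have full: "{w ! k..m} \<subseteq> occ"
    by (simp add: park_spot_eq_None_iff occ_def m_def)
  define F where "F = {..<w ! k} - occ"
  define j where "j = Max F"
  have "0 \<in> F"
    using assms(1) p k zero_notin_occupied[of w k m] by (simp add: F_def occ_def)
  then have "j \<in> F"
    unfolding j_def by (intro Max_in) (auto simp: F_def)
  then have j: "j < w ! k" "j \<notin> occ"
    by (auto simp: F_def)
  \<comment> \<open>Below \<open>w ! k\<close> this is the maximality of \<open>j\<close>; from
    \<open>w ! k\<close> on it is the failure of the car.\<close>
  have beyond: "x \<in> occ" if "j < x" "x \<le> m" for x
  proof (rule ccontr)
    assume "x \<notin> occ"
    with full that(2) have "x < w ! k"
      by (meson atLeastAtMost_iff not_le subsetD)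
    with \<open>x \<notin> occ\<close> have "x \<in> F"
      by (simp add: F_def)
    then have "x \<le> j"
      by (simp add: j_def F_def)
    with that show False
      by simp
  qed
  have "finite occ" "card (occ \<inter> {j<..}) \<le> length (filter (\<lambda>x. j < x) (take k w))"
    using card_occupied_beyond_free_spot[of w k j m] assms(1) k j by (auto simp: occ_def)
  moreover have "card {j<..m} \<le> card (occ \<inter> {j<..})"
    using \<open>finite occ\<close> beyond by (intro card_mono) auto
  moreover have "w = take k w @ w ! k # drop (Suc k) w"
    using k by (rule id_take_nth_drop)
  then have "filter (\<lambda>x. j < x) w =
      filter (\<lambda>x. j < x) (take k w) @ filter (\<lambda>x. j < x) (w ! k # drop (Suc k) w)"
    by (metis filter_append)
  \<comment> \<open>Strict, since the failing car prefers a spot beyond \<open>j\<close> but is not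
    among the first \<open>k\<close> cars.\<close>
  then have "length (filter (\<lambda>x. j < x) (take k w)) < length (filter (\<lambda>x. j < x) w)"
    using j(1) by simp
  ultimately have "m - j < length (filter (\<lambda>x. j < x) w)"
    by simp
  \<comment> \<open>No preference exceeds \<open>m\<close>, so \<open>j < w ! k \<le> m\<close> and
    \<open>few\<close> applies to \<open>j\<close>.\<close>
  moreover have "length (filter (\<lambda>x. m < x) w) \<le> 0"
    using few[of m] by (simp add: m_def)
  then have "w ! k \<le> m"
    using k by (simp add: filter_empty_conv not_less)
  ultimately show False
    using few[of j] j(1) by (simp add: m_def)
qed

text \<open>Each car takes a new spot among as many spots as there are cars, so none stays
  free.\<close>

lemma occupied_length:
  assumes "0 \<notin> set w"
    and all: "\<And>k. k < length w \<Longrightarrow>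
      park_spot (length w) (occupied (length w) w k) (w ! k) \<noteq> None"
  shows "occupied (length w) w (length w) = {1..length w}"
proof -
  have "occupied (length w) w k \<subseteq> {1..length w} \<and> card (occupied (length w) w k) = k"
    if "k \<le> length w" for k
    using that
  proof (induction k)
    case (Suc k)
    have p: "w ! k \<ge> 1"
      using one_le_nth[OF assms(1)] Suc.prems by simp
    obtain s where s: "park_spot (length w) (occupied (length w) w k) (w ! k) = Some s"
      using all[of k] Suc.prems by auto
    then have "s \<in> {1..length w}" "s \<notin> occupied (length w) w k"
      using p by (auto simp: park_spot_eq_Some_iff)
    moreover have "finite (occupied (length w) w k)"
      using Suc by (auto intro: finite_subset)
    ultimately show ?case
      using s Suc by simp
  qed simp
  then show ?thesis
    by (intro card_subset_eq) auto
qed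

section \<open>Parking under translation, with further cars appended\<close>

lemma occupied_map_add_append:
  assumes "0 \<notin> set w" "d + length w \<le> m" "k \<le> length w"
    and all: "\<And>k. k < length w \<Longrightarrow>
      park_spot (length w) (occupied (length w) w k) (w ! k) \<noteq> None"
  shows "occupied m (map ((+) d) w @ ys) k = (+) d ` occupied (length w) w k"
  using assms(3)
proof (induction k)
  case (Suc k)
  have p: "w ! k \<ge> 1"
    using one_le_nth[OF assms(1)] Suc.prems by simp
  obtain s where s: "park_spot (length w) (occupied (length w) w k) (w ! k) = Some s"
    using all[of k] Suc.prems by auto
  with p Suc assms(2) show ?case
    by (simp add: nth_append park_spot_shift)
qed simp

lemma car_spot_map_add_append:
  assumes "0 \<notin> set w" "d \<le> length ys" "i \<in> {1..length w}"
    and all: "\<And>k. k < length w \<Longrightarrow>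
      park_spot (length w) (occupied (length w) w k) (w ! k) \<noteq> None"
  shows "car_spot (map ((+) d) w @ ys) i = map_option ((+) d) (car_spot w i)"
proof -
  have k: "i - 1 < length w"
    using assms(3) by auto
  have p: "w ! (i - 1) \<ge> 1"
    using assms(1) k by (rule one_le_nth)
  obtain s where
    "park_spot (length w) (occupied (length w) w (i - 1)) (w ! (i - 1)) = Some s"
    using all[OF k] by auto
  with p k assms show ?thesis
    by (simp add: car_spot_def nth_append occupied_map_add_append park_spot_shift)
qed

text \<open>Preference and final spot of each of these cars both grow by \<open>d\<close>, so
  whether they agree does not change.\<close>

lemma lucky_map_add_append:
  assumes "0 \<notin> set w" "d \<le> length ys"
    and all: "\<And>k. k < length w \<Longrightarrow>
      park_spot (length w) (occupied (length w) w k) (w ! k) \<noteq> None"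
  shows "lucky (map ((+) d) w @ ys) \<inter> {1..length w} = lucky w"
proof -
  have "i \<in> lucky (map ((+) d) w @ ys) \<longleftrightarrow> i \<in> lucky w" if "i \<in> {1..length w}" for i
  proof -
    have "i - 1 < length w"
      using that by auto
    then show ?thesis
      using car_spot_map_add_append[OF assms(1,2) that all] that
      by (auto simp: lucky_def nth_append)
  qed
  then show ?thesis
    by (auto simp: lucky_def)
qed

section \<open>Stirling permutations\<close>

lemma set_stirling_permutation:
  assumes "w \<in> stirling_permutations n"
  shows "set w = {1..n}"
proof -
  have "set_mset (mset w) = {1..n}"
    using assms by (simp add: stirling_permutations_def)
  then show ?thesis
    by simp
qed

lemma length_filter_greater_stirling_permutation:
  assumes "w \<in> stirling_permutations n"
  shows "length (filter (\<lambda>x. j < x) w) = 2 * (n - j)"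
proof -
  have "length (filter (\<lambda>x. j < x) w) = size (filter_mset (\<lambda>x. j < x) (mset w))"
    by (metis mset_filter size_mset)
  also have "\<dots> = 2 * card {x \<in> {1..n}. j < x}"
    using assms by (simp add: stirling_permutations_def)
  also have "{x \<in> {1..n}. j < x} = {j<..n}"
    by auto
  finally show ?thesis
    by simp
qed

lemma length_stirling_permutation:
  assumes "w \<in> stirling_permutations n"
  shows "length w = 2 * n"
proof -
  have "length w = size (mset w)"
    by simp
  also have "\<dots> = 2 * n"
    using assms by (simp add: stirling_permutations_def del: size_mset)
  finally show ?thesis .
qed

text \<open>The counting hypothesis of \<open>park_spot_ne_None\<close> holds because
  \<open>2 * (n - j) \<le> 2 * n - j\<close>.\<close>

lemma all_cars_park_stirling_permutation:
  assumes "w \<in> stirling_permutations n" "k < length w"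
  shows "park_spot (length w) (occupied (length w) w k) (w ! k) \<noteq> None"
  using assms set_stirling_permutation[OF assms(1)]
  by (intro park_spot_ne_None)
    (auto simp: length_filter_greater_stirling_permutation length_stirling_permutation)

text \<open>The two copies of \<open>v\<close> are adjacent, with nothing between them, and
  \<open>v\<close> is new, so every pair of equal letters with something between lies in
  \<open>xs\<close>. Serves both a new maximum and a new minimum.\<close>

lemma stirling_order_append_twice:
  fixes xs :: "nat list"
  assumes xs: "\<And>a b c. a < b \<Longrightarrow> b < c \<Longrightarrow> c < length xs \<Longrightarrow> xs ! a = xs ! c \<Longrightarrow>
      xs ! a < xs ! b"
    and v: "v \<notin> set xs"
    and abc: "a < b" "b < c" "c < length (xs @ [v, v])" "(xs @ [v, v]) ! a = (xs @ [v, v]) ! c"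
  shows "(xs @ [v, v]) ! a < (xs @ [v, v]) ! b"
proof -
  \<comment> \<open>At least two positions follow \<open>a\<close>, so \<open>a\<close> cannot be
    one of the last two.\<close>
  have a: "a < length xs"
    using abc by auto
  have "c < length xs"
  proof (rule ccontr)
    assume "\<not> c < length xs"
    then have "(xs @ [v, v]) ! c = v"
      using abc by (auto simp: nth_append nth_Cons')
    with abc a have "xs ! a = v"
      by (simp add: nth_append)
    with a v show False
      by (metis nth_mem)
  qed
  with a abc xs[of a b c] show ?thesis
    by (simp add: nth_append)
qed

section \<open>Two passages from order \<open>n\<close> to order \<open>n + 1\<close>\<close>

lemma stirling_permutations_append_max:
  assumes "w \<in> stirling_permutations n"
  shows "w @ [n + 1, n + 1] \<in> stirling_permutations (n + 1)"
proof -
  have "mset (w @ [n + 1, n + 1]) = mset_set {1..n + 1} + mset_set {1..n + 1}"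
    using assms by (simp add: stirling_permutations_def atLeastAtMostSuc_conv)
  moreover have "n + 1 \<notin> set w"
    using assms by (simp add: set_stirling_permutation)
  ultimately show ?thesis
    using stirling_order_append_twice[of w "n + 1"] assms
    unfolding stirling_permutations_def by blast
qed

lemma stirling_permutations_map_Suc_append_min:
  assumes "w \<in> stirling_permutations n"
  shows "map Suc w @ [1, 1] \<in> stirling_permutations (n + 1)"
proof -
  have "{1..n + 1} = insert 1 (Suc ` {1..n})"
    by auto
  then have "mset_set {1..n + 1} = add_mset 1 (image_mset Suc (mset_set {1..n}))"
    by (simp add: image_mset_mset_set)
  then have m: "mset (map Suc w @ [1, 1]) = mset_set {1..n + 1} + mset_set {1..n + 1}"
    using assms by (simp add: stirling_permutations_def)
  have "1 \<notin> set (map Suc w)"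
    using assms by (auto simp: set_stirling_permutation)
  moreover have "map Suc w ! a < map Suc w ! b"
    if "a < b" "b < c" "c < length (map Suc w)" "map Suc w ! a = map Suc w ! c" for a b c
    using assms that by (auto simp: stirling_permutations_def)
  ultimately show ?thesis
    using stirling_order_append_twice[of "map Suc w" 1] m
    unfolding stirling_permutations_def by blast
qed

theorem theorem3p3:
  fixes n :: nat and S :: "nat set"
  assumes "n \<ge> 1" and "admissible_lucky_set n S"
  shows "admissible_lucky_set (n + 1) S \<and> admissible_lucky_set (n + 1) (S \<union> {2 * n + 1})"
proof -
  obtain w where S: "S \<subseteq> {1..2 * n}" and w: "w \<in> stirling_permutations n" "lucky w = S"
    using assms(2) by (auto simp: admissible_lucky_set_def)
  have len: "length w = 2 * n"
    using w(1) by (rule length_stirling_permutation)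
  have pos: "0 \<notin> set w"
    using w(1) by (simp add: set_stirling_permutation)
  note all = all_cars_park_stirling_permutation[OF w(1)]
  have full: "occupied (2 * n) w (2 * n) = {1..2 * n}"
    using occupied_length[OF pos all] by (simp add: len)
  \<comment> \<open>Only the last two cars remain to be examined; the first \<open>2 * n\<close> are
    covered by \<open>lucky_map_add_append\<close>.\<close>
  have split: "lucky (xs @ [v, v]) =
      (lucky (xs @ [v, v]) \<inter> {1..2 * n}) \<union>
      {i \<in> {2 * n + 1, 2 * n + 2}. car_spot (xs @ [v, v]) i = Some v}"
    if "length xs = 2 * n" for xs v
  proof -
    have "(xs @ [v, v]) ! (i - 1) = v" if "i \<in> {2 * n + 1, 2 * n + 2}" for i
      using that \<open>length xs = 2 * n\<close> by (auto simp: nth_append)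
    moreover have "{1..length (xs @ [v, v])} = {1..2 * n} \<union> {2 * n + 1, 2 * n + 2}"
      using that by auto
    ultimately show ?thesis
      unfolding lucky_def by force
  qed
  define x where "x = w @ [n + 1, n + 1]"
  define y where "y = map Suc w @ [1, 1]"
  have maps: "map ((+) 0) w = w" "map ((+) 1) w = map Suc w"
    by (auto intro: map_idI)
  have first: "lucky x \<inter> {1..2 * n} = S" "lucky y \<inter> {1..2 * n} = S"
    using lucky_map_add_append[OF pos _ all, of 0 "[n + 1, n + 1]"]
      lucky_map_add_append[OF pos _ all, of 1 "[1, 1]"] w(2)
    unfolding maps by (simp_all add: len x_def y_def)
  have lenx: "length x = 2 * n + 2" and leny: "length y = 2 * n + 2"
    by (simp_all add: x_def y_def len)
  have occx: "occupied (2 * n + 2) x (2 * n) = {1..2 * n}"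
    using occupied_map_add_append[OF pos _ _ all, of 0 "2 * n + 2" "2 * n" "[n + 1, n + 1]"]
    unfolding maps by (simp add: len full x_def)
  have occy: "occupied (2 * n + 2) y (2 * n) = {2..2 * n + 1}"
    using occupied_map_add_append[OF pos _ _ all, of 1 "2 * n + 2" "2 * n" "[1, 1]"]
    unfolding maps by (simp add: len full y_def)
  have nth: "x ! (2 * n) = n + 1" "x ! (2 * n + 1) = n + 1" "y ! (2 * n) = 1" "y ! (2 * n + 1) = 1"
    by (simp_all add: x_def y_def nth_append len)
  \<comment> \<open>As \<open>n \<ge> 1\<close>, spot \<open>n + 1\<close> lies in
    \<open>{1..2 * n}\<close>; it is taken before both cars arrive.\<close>
  have "car_spot x (2 * n + 1) \<noteq> Some (n + 1)" "car_spot x (2 * n + 2) \<noteq> Some (n + 1)"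
    using assms(1) occx nth by (auto simp: car_spot_def lenx park_spot_eq_Some_iff)
  then have "lucky x = S"
    using split[of w "n + 1"] first len by (auto simp: x_def)
  \<comment> \<open>The spot of car \<open>2 * n + 1\<close>; it is also what makes spot 1 occupied
    when car \<open>2 * n + 2\<close> arrives.\<close>
  moreover have "park_spot (2 * n + 2) {2..2 * n + 1} 1 = Some 1"
    by (simp add: park_spot_eq_Some_iff)
  then have "car_spot y (2 * n + 1) = Some 1" "car_spot y (2 * n + 2) \<noteq> Some 1"
    using occy nth by (auto simp: car_spot_def leny park_spot_eq_Some_iff)
  then have "lucky y = S \<union> {2 * n + 1}"
    using split[of "map Suc w" 1] first len by (auto simp: y_def)
  moreover have "x \<in> stirling_permutations (n + 1)" "y \<in> stirling_permutations (n + 1)"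
    using w(1) stirling_permutations_append_max stirling_permutations_map_Suc_append_min
    by (simp_all add: x_def y_def)
  moreover have "S \<subseteq> {1..2 * (n + 1)}" "S \<union> {2 * n + 1} \<subseteq> {1..2 * (n + 1)}"
    using S by auto
  ultimately show ?thesis
    unfolding admissible_lucky_set_def by blast
qed

end
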